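(* $H_{2^n}$ is uncollapsed for all $n \geq 3$; $H_{3^n}$ is uncollapsed for all $n \geq 2$; $H_{5^n}$ is uncollapsed for all $n \geq 1$.
   Context: For a positive integer $m$, $H_m = \langle a,b,c \mid a^2,b^2,c^2,(ab)^3,(ac)^2,(bc)^m,(bac)^m\rangle$. For positive integers $m,k$ we write $H_m = H_k$ if the two presentations define the same quotient of the free group on $a,b,c$ (the normal closures of the relator sets in the free group coincide). $H_m$ is called uncollapsed if $H_m \neq H_k$ for all integers $1 \leq k < m$. *)

theory Defs
  imports "HOL-Algebra.Coset"
begin

text \<open>
  The free group on the type \<open>'a\<close>, realised by reduced words. A letter \<open>(True, x)\<close> stands for the
  generator \<open>x\<close>, and \<open>(False, x)\<close> for its inverse.
\<close>

type_synonym 'a letter = "bool \<times> 'a"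

definition inv_letter :: "'a letter \<Rightarrow> 'a letter" where
  "inv_letter l = (\<not> fst l, snd l)"

fun reduced :: "'a letter list \<Rightarrow> bool" where
  "reduced [] \<longleftrightarrow> True"
| "reduced [l] \<longleftrightarrow> True"
| "reduced (l # l' # w) \<longleftrightarrow> l' \<noteq> inv_letter l \<and> reduced (l' # w)"

fun cons_reduce :: "'a letter \<Rightarrow> 'a letter list \<Rightarrow> 'a letter list" where
  "cons_reduce l [] = [l]"
| "cons_reduce l (l' # w) = (if l' = inv_letter l then w else l # l' # w)"

definition reduce :: "'a letter list \<Rightarrow> 'a letter list" where
  "reduce w = foldr cons_reduce w []"

definition free_group :: "'a letter list monoid" where
  "free_group = \<lparr>carrier = {w. reduced w}, mult = (\<lambda>u v. reduce (u @ v)), one = []\<rparr>"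

definition free_gen :: "'a \<Rightarrow> 'a letter list" where
  "free_gen x = [(True, x)]"

definition normal_closure :: "('g, 'm) monoid_scheme \<Rightarrow> 'g set \<Rightarrow> 'g set" where
  "normal_closure G R = \<Inter>{N. N \<lhd> G \<and> R \<subseteq> N}"

datatype abc = A | B | C

definition H_relators :: "nat \<Rightarrow> abc letter list set" where
  "H_relators m =
    (let F = free_group; a = free_gen A; b = free_gen B; c = free_gen C in
     {a [^]\<^bsub>F\<^esub> (2::nat), b [^]\<^bsub>F\<^esub> (2::nat), c [^]\<^bsub>F\<^esub> (2::nat),
      (a \<otimes>\<^bsub>F\<^esub> b) [^]\<^bsub>F\<^esub> (3::nat), (a \<otimes>\<^bsub>F\<^esub> c) [^]\<^bsub>F\<^esub> (2::nat),
      (b \<otimes>\<^bsub>F\<^esub> c) [^]\<^bsub>F\<^esub> m, (b \<otimes>\<^bsub>F\<^esub> a \<otimes>\<^bsub>F\<^esub> c) [^]\<^bsub>F\<^esub> m})"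

definition H :: "nat \<Rightarrow> abc letter list set monoid" where
  "H m = free_group Mod normal_closure free_group (H_relators m)"

text \<open>
  Equality of \<open>H m\<close> and \<open>H k\<close> means equality as quotients of the free group, not isomorphism.
  Stated for the normal closures; by \<open>H_eq_iff\<close> below this is the same as \<open>H m = H k\<close>.
\<close>

definition same_quotient :: "nat \<Rightarrow> nat \<Rightarrow> bool" where
  "same_quotient m k \<longleftrightarrow>
     normal_closure free_group (H_relators m) = normal_closure free_group (H_relators k)"

definition uncollapsed :: "nat \<Rightarrow> bool" where
  "uncollapsed m \<longleftrightarrow> (\<forall>k. 1 \<le> k \<and> k < m \<longrightarrow> \<not> same_quotient m k)"

lemma inv_letter_inv_letter [simp]: "inv_letter (inv_letter l) = l"
  by (simp add: inv_letter_def)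

lemma reduced_tl: "reduced (l # w) \<Longrightarrow> reduced w"
  by (cases w) auto

lemma reduced_cons_reduce: "reduced w \<Longrightarrow> reduced (cons_reduce l w)"
  by (cases w) (auto dest: reduced_tl)

lemma reduced_foldr: "reduced v \<Longrightarrow> reduced (foldr cons_reduce u v)"
  by (induction u) (auto intro: reduced_cons_reduce)

lemma reduced_reduce: "reduced (reduce w)"
  by (simp add: reduce_def reduced_foldr)

lemma reduce_reduced: "reduced w \<Longrightarrow> reduce w = w"
proof (induction w)
  case (Cons l w)
  then have "reduce w = w" by (auto dest: reduced_tl)
  with Cons.prems show ?case by (cases w) (auto simp: reduce_def)
qed (simp add: reduce_def)

lemma reduce_append: "reduce (u @ v) = foldr cons_reduce u (reduce v)"
  by (simp add: reduce_def)

lemma cons_reduce_inv_letter: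
  "reduced w \<Longrightarrow> cons_reduce l (cons_reduce (inv_letter l) w) = w"
proof (cases w)
  case (Cons l' w')
  assume "reduced w"
  with Cons show ?thesis by (cases w') auto
qed simp

lemma foldr_cons_reduce:
  assumes "reduced v"
  shows "foldr cons_reduce (cons_reduce l u) v = cons_reduce l (foldr cons_reduce u v)"
proof (cases u)
  case (Cons l' u')
  then show ?thesis
    using cons_reduce_inv_letter[OF reduced_foldr[OF assms]] by auto
qed simp

lemma foldr_reduce:
  assumes "reduced v"
  shows "foldr cons_reduce (reduce u) v = foldr cons_reduce u v"
  by (induction u) (simp_all add: reduce_def foldr_cons_reduce[OF assms])

lemma reduce_append_reduce_left: "reduce (reduce u @ v) = reduce (u @ v)"
  by (simp add: reduce_append foldr_reduce reduced_reduce)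

lemma reduce_append_reduce_right: "reduce (u @ reduce v) = reduce (u @ v)"
  by (simp add: reduce_append reduce_reduced reduced_reduce)

lemma foldr_inverse_word:
  "reduced v \<Longrightarrow> foldr cons_reduce (rev (map inv_letter w)) (foldr cons_reduce w v) = v"
proof (induction w)
  case (Cons l w)
  then show ?case
    using cons_reduce_inv_letter[OF reduced_foldr[OF Cons.prems], of "inv_letter l" w] by simp
qed simp

theorem group_free_group: "group (free_group :: 'a letter list monoid)"
proof (rule groupI)
  fix x y z :: "'a letter list"
  show "\<one>\<^bsub>free_group\<^esub> \<in> carrier (free_group :: 'a letter list monoid)"
    by (simp add: free_group_def)
  show "x \<otimes>\<^bsub>free_group\<^esub> y \<in> carrier free_group"
    by (simp add: free_group_def reduced_reduce)
  show "x \<otimes>\<^bsub>free_group\<^esub> y \<otimes>\<^bsub>free_group\<^esub> z = x \<otimes>\<^bsub>free_group\<^esub> (y \<otimes>\<^bsub>free_group\<^esub> z)"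
    by (simp add: free_group_def reduce_append_reduce_left reduce_append_reduce_right)
  show "\<one>\<^bsub>free_group\<^esub> \<otimes>\<^bsub>free_group\<^esub> x = x" if "x \<in> carrier free_group"
    using that by (simp add: free_group_def reduce_reduced)
  show "\<exists>y\<in>carrier free_group. y \<otimes>\<^bsub>free_group\<^esub> x = \<one>\<^bsub>free_group\<^esub>" if "x \<in> carrier free_group"
  proof
    have "reduce (rev (map inv_letter x) @ x) = []"
      using foldr_inverse_word[of "[]" x] by (simp add: reduce_def)
    then show "reduce (rev (map inv_letter x)) \<otimes>\<^bsub>free_group\<^esub> x = \<one>\<^bsub>free_group\<^esub>"
      by (simp add: free_group_def reduce_append_reduce_left)
  qed (simp add: free_group_def reduced_reduce)
qed

lemma H_eq_iff: "H m = H k \<longleftrightarrow> same_quotient m k"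
  by (auto simp: H_def same_quotient_def FactGroup_def)

end

theory Submission
  imports Defs "HOL-Computational_Algebra.Primes"
begin

text \<open>
  The Coxeter group with Cartan entries \<open>A\<^sub>a\<^sub>b A\<^sub>b\<^sub>a = 1\<close>, \<open>A\<^sub>a\<^sub>c = 0\<close>, \<open>A\<^sub>b\<^sub>c A\<^sub>c\<^sub>b = t\<close> acts on \<open>\<int>\<^sup>3\<close> by
  reflections for every integer \<open>t\<close>. Letting \<open>a, b, c\<close> act by the negatives of these reflections,
  \<open>bc\<close> has eigenvalues \<open>1, \<zeta>, \<zeta>\<^sup>-\<^sup>1\<close> with \<open>\<zeta> + \<zeta>\<^sup>-\<^sup>1 = t - 2\<close>, and \<open>bac\<close> has eigenvalues
  \<open>1, \<eta>, \<eta>\<^sup>-\<^sup>1\<close> with \<open>\<eta> + \<eta>\<^sup>-\<^sup>1 = 1 - t\<close>. For each prime power \<open>p\<^sup>n\<close> in the theorem we choose \<open>t\<close> and a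
  modulus \<open>N\<close> such that modulo \<open>N\<close> the element \<open>bc\<close> has order exactly \<open>p\<^sup>n\<close> and the order of \<open>bac\<close>
  divides \<open>p\<^sup>n\<close>. If \<open>H\<^sub>m = H\<^sub>k\<close> for some \<open>k < m = p\<^sup>n\<close>, then the order of \<open>bc\<close> would divide
  \<open>gcd m k\<close>, hence \<open>p\<^sup>n\<^sup>-\<^sup>1\<close>.

  For \<open>p = 5\<close> take \<open>t = 4\<close> and \<open>N = 5\<^sup>n\<close>; both elements are unipotent modulo 5. For \<open>p = 2, 3\<close> take
  \<open>t = 3/2\<close> modulo \<open>N\<close>, so that \<open>\<zeta> + \<zeta>\<^sup>-\<^sup>1 = \<eta> + \<eta>\<^sup>-\<^sup>1 = -1/2\<close>, and let \<open>N\<close> be, up to sign, the norm of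
  \<open>1 + 2 (\<zeta> + \<zeta>\<^sup>-\<^sup>1)\<close> for a primitive \<open>p\<^sup>n\<close>-th root of unity \<open>\<zeta>\<close>. It is expressed by a Lucas sequence,
  and congruences modulo 8 and 3 show that it is not a unit.
\<close>

section \<open>Reflections modulo N\<close>

text \<open>The sign gives each generator determinant 1, so that the odd word \<open>bac\<close> can
  have odd order; the relators other than the power of \<open>bac\<close> have even length and do
  not see it.\<close>

fun neg_refl :: "int \<Rightarrow> abc \<Rightarrow> (abc \<Rightarrow> int) \<Rightarrow> abc \<Rightarrow> int" where
  "neg_refl t A v = (\<lambda>y. - v y)(A := v A - v B)"
| "neg_refl t B v = (\<lambda>y. - v y)(B := v B - v A - t * v C)"
| "neg_refl t C v = (\<lambda>y. - v y)(C := v C - v B)"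

text \<open>Every generator acts by an involution, so the exponent sign of a letter is irrelevant.\<close>

definition act :: "int \<Rightarrow> abc letter list \<Rightarrow> (abc \<Rightarrow> int) \<Rightarrow> abc \<Rightarrow> int" where
  "act t w = foldr (\<lambda>l. neg_refl t (snd l)) w"

definition vcong :: "int \<Rightarrow> (abc \<Rightarrow> int) \<Rightarrow> (abc \<Rightarrow> int) \<Rightarrow> bool" where
  "vcong N u v \<longleftrightarrow> (\<forall>y. N dvd u y - v y)"

lemma vcong_refl [simp]: "vcong N v v"
  by (simp add: vcong_def)

lemma vcong_sym: "vcong N u v \<Longrightarrow> vcong N v u"
  by (simp add: vcong_def dvd_diff_commute)

lemma vcong_trans [trans]: "vcong N u v \<Longrightarrow> vcong N v w \<Longrightarrow> vcong N u w"
  unfolding vcong_def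
proof
  fix y assume "\<forall>y. N dvd u y - v y" "\<forall>y. N dvd v y - w y"
  then have "N dvd (u y - v y) + (v y - w y)" by (intro dvd_add) auto
  then show "N dvd u y - w y" by simp
qed

lemma all_abc: "(\<forall>y. P y) \<longleftrightarrow> P A \<and> P B \<and> P C"
proof
  assume "P A \<and> P B \<and> P C"
  then have "P y" for y by (cases y) auto
  then show "\<forall>y. P y" ..
qed blast

lemma ext_abc: "f A = g A \<Longrightarrow> f B = g B \<Longrightarrow> f C = g C \<Longrightarrow> f = g"
  using all_abc[of "\<lambda>y. f y = g y"] by blast

lemma neg_refl_neg_refl: "neg_refl t x (neg_refl t x v) = v"
  by (cases x; rule ext_abc) simp_all

lemma vcong_neg_refl_mono:
  assumes "vcong N u v"
  shows "vcong N (neg_refl t x u) (neg_refl t x v)"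
proof -
  have neg: "N dvd b - a" if "N dvd a - b" for a b :: int
    using that by (simp add: dvd_diff_commute)
  have sub: "N dvd (a - c) - (b - d)" if "N dvd a - b" "N dvd c - d" for a b c d :: int
    using dvd_diff[OF that] by (simp add: algebra_simps)
  have mult: "N dvd t * a - t * b" if "N dvd a - b" for a b :: int
    using dvd_mult[OF that, of t] by (simp add: algebra_simps)
  have "N dvd u A - v A" "N dvd u B - v B" "N dvd u C - v C"
    using assms by (auto simp: vcong_def)
  then show ?thesis
    unfolding vcong_def all_abc
    by (cases x) (simp_all add: neg sub mult)
qed

lemma act_Nil [simp]: "act t [] v = v"
  by (simp add: act_def)

lemma act_append: "act t (u @ w) v = act t u (act t w v)"
  by (simp add: act_def)

lemma act_cons_reduce: "act t (cons_reduce l w) v = act t (l # w) v"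
  by (cases w) (auto simp: act_def inv_letter_def neg_refl_neg_refl)

lemma act_reduce: "act t (reduce w) v = act t w v"
proof (induction w)
  case (Cons l w)
  have "act t (reduce (l # w)) v = neg_refl t (snd l) (act t (reduce w) v)"
    using act_cons_reduce[of t l "reduce w" v] by (simp add: reduce_def act_def)
  with Cons show ?case by (simp add: act_def)
qed (simp add: reduce_def)

lemma vcong_act_mono: "vcong N u v \<Longrightarrow> vcong N (act t w u) (act t w v)"
  by (induction w) (auto simp: act_def vcong_neg_refl_mono)

lemma act_mult: "act t (u \<otimes>\<^bsub>free_group\<^esub> w) v = act t u (act t w v)"
  by (simp add: free_group_def act_reduce act_append)

lemma act_one: "act t \<one>\<^bsub>free_group\<^esub> v = v"
  by (simp add: free_group_def)

lemma act_pow: "act t (w [^]\<^bsub>free_group\<^esub> (n::nat)) v = (act t w ^^ n) v"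
proof (induction n arbitrary: v)
  case 0
  then show ?case by (simp add: act_one)
next
  case (Suc n)
  then show ?case by (simp add: act_mult funpow_swap1)
qed

lemma act_gen: "act t (free_gen x) v = neg_refl t x v"
  by (simp add: act_def free_gen_def)

section \<open>The congruence kernel of the action\<close>

definition act_kernel :: "int \<Rightarrow> int \<Rightarrow> abc letter list set" where
  "act_kernel t N = {w \<in> carrier free_group. \<forall>v. vcong N (act t w v) v}"

lemma act_kernel_normal: "act_kernel t N \<lhd> free_group"
proof -
  interpret F: group "free_group :: abc letter list monoid"
    by (rule group_free_group)
  have inv_left: "act t (inv\<^bsub>free_group\<^esub> w) (act t w v) = v"
    if "w \<in> carrier free_group" for w v
    using that by (simp flip: act_mult add: act_one)
  have inv_right: "act t w (act t (inv\<^bsub>free_group\<^esub> w) v) = v"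
    if "w \<in> carrier free_group" for w v
    using that by (simp flip: act_mult add: act_one)
  have sub: "subgroup (act_kernel t N) free_group"
  proof (rule F.subgroupI)
    show "act_kernel t N \<subseteq> carrier free_group"
      by (auto simp: act_kernel_def)
    have "\<one>\<^bsub>free_group\<^esub> \<in> act_kernel t N"
      by (simp add: act_kernel_def act_one)
    then show "act_kernel t N \<noteq> {}" by blast
  next
    fix w assume w: "w \<in> act_kernel t N"
    have "vcong N (act t (inv\<^bsub>free_group\<^esub> w) v) v" for v
      using w inv_left[of w v]
        vcong_act_mono[of N v "act t w v" t "inv\<^bsub>free_group\<^esub> w"]
      by (simp add: act_kernel_def vcong_sym)
    then show "inv\<^bsub>free_group\<^esub> w \<in> act_kernel t N"
      using w by (simp add: act_kernel_def)
  next
    fix u w assume "u \<in> act_kernel t N" "w \<in> act_kernel t N"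
    then show "u \<otimes>\<^bsub>free_group\<^esub> w \<in> act_kernel t N"
      by (auto simp: act_kernel_def act_mult intro: vcong_trans)
  qed
  have conj: "x \<otimes>\<^bsub>free_group\<^esub> w \<otimes>\<^bsub>free_group\<^esub> inv\<^bsub>free_group\<^esub> x \<in> act_kernel t N"
    if x: "x \<in> carrier free_group" and w: "w \<in> act_kernel t N" for x w
  proof -
    have "vcong N (act t x (act t w (act t (inv\<^bsub>free_group\<^esub> x) v))) v" for v
      using w inv_right[OF x, of v]
        vcong_act_mono[of N "act t w (act t (inv\<^bsub>free_group\<^esub> x) v)" "act t (inv\<^bsub>free_group\<^esub> x) v" t x]
      by (simp add: act_kernel_def)
    then show ?thesis
      using x w by (simp add: act_kernel_def act_mult)
  qed
  show ?thesis
    using sub conj by (auto simp: F.normal_inv_iff)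
qed

definition bc :: "int \<Rightarrow> (abc \<Rightarrow> int) \<Rightarrow> abc \<Rightarrow> int" where
  "bc t v = neg_refl t B (neg_refl t C v)"

definition bac :: "int \<Rightarrow> (abc \<Rightarrow> int) \<Rightarrow> abc \<Rightarrow> int" where
  "bac t v = neg_refl t B (neg_refl t A (neg_refl t C v))"

lemma act_bc: "act t (free_gen B \<otimes>\<^bsub>free_group\<^esub> free_gen C) = bc t"
  by (rule ext) (simp add: act_mult act_gen bc_def)

lemma act_bac:
  "act t (free_gen B \<otimes>\<^bsub>free_group\<^esub> free_gen A \<otimes>\<^bsub>free_group\<^esub> free_gen C) = bac t"
  by (rule ext) (simp add: act_mult act_gen bac_def)

lemma bc_pow_kernel:
  assumes "(free_gen B \<otimes>\<^bsub>free_group\<^esub> free_gen C) [^]\<^bsub>free_group\<^esub> (k::nat) \<in> act_kernel t N"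
  shows "vcong N ((bc t ^^ k) v) v"
  using assms by (auto simp: act_kernel_def act_pow act_bc)

text \<open>The other five relators act trivially over the integers, for every
  \<open>t\<close>.\<close>

lemma H_relators_subset_kernel:
  assumes "\<And>v. vcong N ((bc t ^^ m) v) v" and "\<And>v. vcong N ((bac t ^^ m) v) v"
  shows "H_relators m \<subseteq> act_kernel t N"
proof -
  interpret F: group "free_group :: abc letter list monoid"
    by (rule group_free_group)
  have gen: "free_gen x \<in> carrier free_group" for x :: abc
    by (simp add: free_gen_def free_group_def)
  have "neg_refl t A (neg_refl t B (neg_refl t A (neg_refl t B (neg_refl t A (neg_refl t B v))))) = v" for v
    by (rule ext_abc) (auto simp: algebra_simps)
  moreover have "neg_refl t A (neg_refl t C (neg_refl t A (neg_refl t C v))) = v" for v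
    by (rule ext_abc) auto
  ultimately show ?thesis
    using assms
    by (simp del: neg_refl.simps add: H_relators_def Let_def act_kernel_def gen act_pow act_bc act_bac)
       (simp del: neg_refl.simps add: numeral_2_eq_2 numeral_3_eq_3 act_mult act_gen neg_refl_neg_refl)
qed

section \<open>Reduction to the order of \<open>bc\<close>\<close>

lemma funpow_mult_vcong:
  assumes "\<And>v. vcong N ((f ^^ k) v) v"
  shows "vcong N ((f ^^ (k * j)) v) v"
proof (induction j)
  case (Suc j)
  have "(f ^^ (k * Suc j)) v = (f ^^ k) ((f ^^ (k * j)) v)"
    by (simp add: funpow_add)
  with assms Suc show ?case by (metis vcong_trans)
qed simp

text \<open>Bezout in the form \<open>k * x = m * y + gcd k m\<close> uses no inverse of
  \<open>f\<close>.\<close>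

lemma funpow_gcd_vcong:
  assumes k: "\<And>v. vcong N ((f ^^ k) v) v" and m: "\<And>v. vcong N ((f ^^ m) v) v" and "k \<noteq> 0"
  shows "vcong N ((f ^^ gcd k m) v) v"
proof -
  obtain x y where xy: "k * x = m * y + gcd k m"
    using bezout_nat[OF \<open>k \<noteq> 0\<close>] by blast
  have "vcong N ((f ^^ gcd k m) v) ((f ^^ (m * y)) ((f ^^ gcd k m) v))"
    by (rule vcong_sym, rule funpow_mult_vcong) (rule m)
  also have "(f ^^ (m * y)) ((f ^^ gcd k m) v) = (f ^^ (k * x)) v"
    by (simp add: xy funpow_add)
  also have "vcong N \<dots> v"
    by (rule funpow_mult_vcong) (rule k)
  finally show ?thesis .
qed

lemma uncollapsed_prime_power:
  assumes "prime p" and "n \<ge> 1"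
    and bc: "\<And>v. vcong N ((bc t ^^ (p ^ n)) v) v"
    and bac: "\<And>v. vcong N ((bac t ^^ (p ^ n)) v) v"
    and nontriv: "\<not> (\<forall>v. vcong N ((bc t ^^ (p ^ (n - 1))) v) v)"
  shows "uncollapsed (p ^ n)"
  unfolding uncollapsed_def
proof (intro allI impI notI)
  fix k assume k: "1 \<le> k \<and> k < p ^ n" and same: "same_quotient (p ^ n) k"
  let ?w = "(free_gen B \<otimes>\<^bsub>free_group\<^esub> free_gen C) [^]\<^bsub>free_group\<^esub> k"
  \<comment> \<open>\<open>?w\<close> is itself a relator of \<open>H k\<close>.\<close>
  have "?w \<in> normal_closure free_group (H_relators k)"
    by (auto simp: normal_closure_def H_relators_def Let_def)
  also have "\<dots> = normal_closure free_group (H_relators (p ^ n))"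
    using same by (simp add: same_quotient_def)
  also have "\<dots> \<subseteq> act_kernel t N"
    using H_relators_subset_kernel[OF bc bac] act_kernel_normal
    by (auto simp: normal_closure_def)
  finally have "vcong N ((bc t ^^ k) v) v" for v
    by (rule bc_pow_kernel)
  then have gcd: "vcong N ((bc t ^^ gcd k (p ^ n)) v) v" for v
    using k by (intro funpow_gcd_vcong bc) auto
  obtain j where j: "j \<le> n" "gcd k (p ^ n) = p ^ j"
    using divides_primepow_nat[OF \<open>prime p\<close>] by (metis gcd_dvd2)
  have "j \<noteq> n"
    using k j gcd_le1_nat[of k "p ^ n"] by auto
  with j have "p ^ (n - 1) = gcd k (p ^ n) * p ^ (n - 1 - j)"
    by (simp flip: power_add)
  with nontriv funpow_mult_vcong[OF gcd] show False
    by simp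
qed

section \<open>Sequences with palindromic characteristic polynomial\<close>

text \<open>With \<open>s = \<zeta> + \<zeta>\<^sup>-\<^sup>1\<close>, this is \<open>\<zeta>\<^sup>k + \<zeta>\<^sup>-\<^sup>k\<close>.\<close>

fun dickson :: "int \<Rightarrow> nat \<Rightarrow> int" where
  "dickson s 0 = 2"
| "dickson s (Suc 0) = s"
| "dickson s (Suc (Suc k)) = s * dickson s (Suc k) - dickson s k"

text \<open>For d(i) = \<zeta>^i or \<zeta>^(-i) this is \<zeta>^k + \<zeta>^(-k) times d(i + k).
  The induction carries two consecutive \<open>k\<close>, as the recursion of \<open>dickson\<close>
  has depth two.\<close>

lemma dickson_shift:
  assumes "\<And>i. d (i + 2) = s * d (i + 1) - d i"
  shows "d (i + 2 * k) + d i = dickson s k * d (i + k)"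
proof -
  have "(\<forall>i. d (i + 2 * k) + d i = dickson s k * d (i + k))
      \<and> (\<forall>i. d (i + 2 * Suc k) + d i = dickson s (Suc k) * d (i + Suc k))"
  proof (induction k)
    case 0
    then show ?case using assms by simp
  next
    case (Suc k)
    have "d (i + 2 * Suc (Suc k)) + d i = dickson s (Suc (Suc k)) * d (i + Suc (Suc k))" for i
    proof -
      have 1: "d (i + 1 + 2 * Suc k) + d (i + 1) = dickson s (Suc k) * d (i + Suc (Suc k))"
        using Suc by (metis add.assoc plus_1_eq_Suc)
      have 2: "d (i + 2 + 2 * k) + d (i + 2) = dickson s k * d (i + Suc (Suc k))"
        using Suc by (metis add.assoc add_2_eq_Suc)
      have 3: "d (i + 2 * Suc (Suc k)) = s * d (i + 1 + 2 * Suc k) - d (i + 2 + 2 * k)"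
        using assms[of "i + 2 + 2 * k"] by (simp add: algebra_simps)
      have "dickson s (Suc (Suc k)) * d (i + Suc (Suc k))
          = s * (dickson s (Suc k) * d (i + Suc (Suc k))) - dickson s k * d (i + Suc (Suc k))"
        by (simp add: algebra_simps)
      also have "\<dots> = d (i + 2 * Suc (Suc k)) + d i"
        unfolding 1[symmetric] 2[symmetric] 3 using assms[of i] by (simp add: algebra_simps)
      finally show ?thesis by simp
    qed
    with Suc show ?case by blast
  qed
  then show ?thesis by blast
qed

section \<open>Coordinates of iterates as affine recurrences\<close>

definition affine_rec :: "int \<Rightarrow> (nat \<Rightarrow> int) \<Rightarrow> bool" where
  "affine_rec s x \<longleftrightarrow> (\<exists>c. \<forall>k. x (k + 2) = s * x (k + 1) - x k + c)"

text \<open>Differences at a fixed lag \<open>h\<close> lose the constant, so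
  \<open>dickson_shift\<close> applies.\<close>

lemma affine_rec_diff:
  assumes "affine_rec s x"
  shows "(x (i + 2 * k + h) - x (i + 2 * k)) + (x (i + h) - x i)
    = dickson s k * (x (i + k + h) - x (i + k))"
proof -
  obtain c where c: "\<And>k. x (k + 2) = s * x (k + 1) - x k + c"
    using assms by (auto simp: affine_rec_def)
  have "x (i + 2 + h) - x (i + 2) = s * (x (i + 1 + h) - x (i + 1)) - (x (i + h) - x i)" for i
    using c[of i] c[of "i + h"] by (simp add: algebra_simps)
  from dickson_shift[of "\<lambda>i. x (i + h) - x i", OF this] show ?thesis .
qed

text \<open>\<open>f\<close> is annihilated by (X - 1)(X^2 - s X + 1). Hence the quadratic factor
  applied to the iterates is constant in \<open>k\<close>.\<close>

lemma affine_rec_funpow: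
  assumes "\<And>v y. f (f (f v)) y = (s + 1) * (f (f v) y - f v y) + v y"
  shows "affine_rec s (\<lambda>k. (f ^^ k) v y)"
proof -
  have "(f ^^ (k + 2)) v y - s * (f ^^ (k + 1)) v y + (f ^^ k) v y = f (f v) y - s * f v y + v y"
    for k
  proof (induction k)
    case (Suc k)
    then show ?case using assms[of "(f ^^ k) v" y] by (simp add: algebra_simps)
  qed (simp add: numeral_2_eq_2)
  then show ?thesis
    unfolding affine_rec_def by (intro exI[of _ "f (f v) y - s * f v y + v y"]) (smt (verit))
qed

lemma bc_apply:
  "bc t v A = v A" "bc t v B = v A + (t - 1) * v B - t * v C" "bc t v C = v B - v C"
  by (simp_all add: bc_def algebra_simps)

lemma bac_apply:
  "bac t v A = v A - v B" "bac t v B = v A - t * v B + t * v C" "bac t v C = v C - v B"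
  by (simp_all add: bac_def algebra_simps)

lemma affine_rec_bc: "affine_rec (t - 2) (\<lambda>k. (bc t ^^ k) v y)"
proof (rule affine_rec_funpow)
  show "bc t (bc t (bc t v)) y = (t - 2 + 1) * (bc t (bc t v) y - bc t v y) + v y" for v y
    by (cases y) (simp_all add: bc_apply algebra_simps)
qed

lemma affine_rec_bac: "affine_rec (1 - t) (\<lambda>k. (bac t ^^ k) v y)"
proof (rule affine_rec_funpow)
  show "bac t (bac t (bac t v)) y = (1 - t + 1) * (bac t (bac t v) y - bac t v y) + v y" for v y
    by (cases y) (simp_all add: bac_apply algebra_simps)
qed

text \<open>The condition makes \<zeta>^k a primitive cube root of unity modulo
  \<open>N\<close>.\<close>

lemma vcong_pow3:
  assumes "\<And>v y. affine_rec s (\<lambda>k. (f ^^ k) v y)" and "N dvd dickson s k + 1"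
  shows "vcong N ((f ^^ (3 * k)) v) v"
  unfolding vcong_def
proof
  fix y
  let ?x = "\<lambda>k. (f ^^ k) v y"
  have "?x (3 * k) - v y = (dickson s k + 1) * (?x (2 * k) - ?x k)"
    using affine_rec_diff[OF assms(1)[of v y], of 0 k k] by (simp add: algebra_simps flip: mult_2_right)
  with assms(2) show "N dvd ?x (3 * k) - v y" by simp
qed

text \<open>Here \<zeta>^(2k) = -1 modulo \<open>N\<close>; the lag \<open>2 * k\<close> makes the
  middle terms cancel.\<close>

lemma vcong_pow4:
  assumes "\<And>v y. affine_rec s (\<lambda>k. (f ^^ k) v y)" and "N dvd dickson s k"
  shows "vcong N ((f ^^ (4 * k)) v) v"
  unfolding vcong_def
proof
  fix y
  let ?x = "\<lambda>k. (f ^^ k) v y"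
  have "?x (4 * k) - v y = dickson s k * (?x (3 * k) - ?x k)"
    using affine_rec_diff[OF assms(1)[of v y], of 0 k "2 * k"] by (simp add: algebra_simps)
  with assms(2) show "N dvd ?x (4 * k) - v y" by simp
qed

lemma dickson_mod_5:
  assumes "5 dvd s - 2"
  shows "5 dvd dickson s k - 2"
  using assms
proof (induction s k rule: dickson.induct)
  case (3 s k)
  then have "5 dvd s * (dickson s (Suc k) - 2) + 2 * (s - 2) - (dickson s k - 2)"
    by (intro dvd_diff[OF dvd_add[OF dvd_mult dvd_mult]])
  also have "\<dots> = dickson s (Suc (Suc k)) - 2"
    by (simp add: algebra_simps)
  finally show ?case .
qed auto

text \<open>Each step gains one factor 5: the fifth cyclotomic polynomial at \<zeta>^k is, up to a
  unit, \<open>dickson s (2 * k) + dickson s k + 1\<close>, which is 2 + 2 + 1 modulo 5.\<close>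

lemma vcong_pow_5:
  assumes rec: "\<And>v y. affine_rec s (\<lambda>k. (f ^^ k) v y)" and s: "5 dvd s - 2"
  shows "vcong (5 ^ n) ((f ^^ (5 ^ n)) v) v"
proof (induction n arbitrary: v)
  case (Suc n)
  define k :: nat where "k = 5 ^ n"
  show ?case
    unfolding vcong_def
  proof
    fix y
    let ?x = "\<lambda>k. (f ^^ k) v y"
    have k2: "k + k = 2 * k" "k + 2 * k = 3 * k" "2 * k + k = 3 * k" "3 * k + k = 4 * k"
        "4 * k + k = 5 * k" "2 * (2 * k) = 4 * k"
      by simp_all
    have "?x (5 * k) - v y = (dickson s (2 * k) + dickson s k + 1) * (?x (3 * k) - ?x (2 * k))"
      using affine_rec_diff[OF rec[of v y], of 0 "2 * k" k] affine_rec_diff[OF rec[of v y], of k k k]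
      unfolding k2 add_0 funpow_0 left_diff_distrib right_diff_distrib distrib_right mult_1
      by linarith
    moreover have "5 dvd dickson s (2 * k) + dickson s k + 1"
      using dickson_mod_5[OF s, of k] dickson_mod_5[OF s, of "2 * k"] by presburger
    moreover have "5 ^ n dvd ?x (3 * k) - ?x (2 * k)"
    proof -
      have "?x (3 * k) = (f ^^ k) ((f ^^ (2 * k)) v) y"
        by (simp flip: funpow_add[THEN fun_cong, unfolded comp_def])
      then show ?thesis using Suc[of "(f ^^ (2 * k)) v"] by (simp add: vcong_def k_def)
    qed
    ultimately show "5 ^ Suc n dvd (f ^^ 5 ^ Suc n) v y - v y"
      by (simp add: mult_dvd_mono k_def)
  qed
qed (simp add: vcong_def)

text \<open>Triviality forces \<zeta>^h = 1, so the trace is 2; in the second claim also \<zeta>^h =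
  -1.\<close>

lemma bc_trivial_dickson:
  assumes "\<And>v. vcong N ((bc t ^^ h) v) v"
  shows bc_trivial_dickson_minus_2: "N dvd dickson (t - 2) h - 2"
    and bc_trivial_dickson_half: "h = 2 * k \<Longrightarrow> N dvd dickson (t - 2) k \<Longrightarrow> N dvd 2"
proof -
  \<comment> \<open>With this start the first difference \<open>d 0\<close> is 1, so no factor is
    lost modulo \<open>N\<close>.\<close>
  define v :: "abc \<Rightarrow> int" where "v = (\<lambda>y. 0)(A := 1)"
  define x where "x = (\<lambda>k. (bc t ^^ k) v B)"
  define d where "d = (\<lambda>i. x (i + 1) - x i)"
  have d0: "d 0 = 1"
    by (simp add: d_def x_def v_def bc_def)
  have per: "N dvd x (h + i) - x i" for i
    using assms[of "(bc t ^^ i) v"] by (simp add: vcong_def x_def funpow_add)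
  have per_d: "N dvd d (h + i) - d i" for i
    using dvd_diff[OF per[of "i + 1"] per[of i]] by (simp add: d_def algebra_simps)
  have rec: "d (2 * k) + 1 = dickson (t - 2) k * d k" for k
    using affine_rec_diff[OF affine_rec_bc[of t v B], of 0 k 1] d0
    unfolding d_def x_def by (simp del: funpow.simps)
  have "N dvd (dickson (t - 2) h - 1) * (d (h + 0) - d 0) - (d (h + h) - d h)"
    by (intro dvd_diff dvd_mult per_d)
  moreover have "(dickson (t - 2) h - 1) * (d (h + 0) - d 0) - (d (h + h) - d h) = 2 - dickson (t - 2) h"
    using rec[of h] d0 by (simp add: algebra_simps flip: mult_2)
  ultimately have "N dvd 2 - dickson (t - 2) h"
    by simp
  then show "N dvd dickson (t - 2) h - 2"
    by (simp add: dvd_diff_commute)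
  assume k: "h = 2 * k" "N dvd dickson (t - 2) k"
  then have "N dvd d h + 1"
    using rec[of k] by simp
  from dvd_diff[OF this per_d[of 0]] show "N dvd 2"
    using d0 by simp
qed

section \<open>A Lucas sequence\<close>

text \<open>For \<open>s = -1/2\<close> this is \<open>2\<^sup>k dickson s k\<close>.\<close>

fun lucas :: "nat \<Rightarrow> int" where
  "lucas 0 = 2"
| "lucas (Suc 0) = - 1"
| "lucas (Suc (Suc k)) = - lucas (Suc k) - 4 * lucas k"

lemma dickson_lucas:
  assumes "N dvd 2 * s + 1"
  shows "N dvd 2 ^ k * dickson s k - lucas k"
  using assms
proof (induction s k rule: dickson.induct)
  case (3 s k)
  let ?e = "\<lambda>k. 2 ^ k * dickson s k - lucas k"
  have "N dvd 2 * s * ?e (Suc k) - 4 * ?e k + (2 * s + 1) * lucas (Suc k)"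
    by (rule dvd_add[OF dvd_diff[OF dvd_mult dvd_mult] dvd_mult2]) (use 3 in blast)+
  also have "\<dots> = ?e (Suc (Suc k))"
    by (simp add: algebra_simps)
  finally show ?case .
qed auto

text \<open>The period 2 modulo 8 begins only at index 2, hence the offsets.\<close>

lemma lucas_mod_8: "lucas (2 * k + 2) mod 8 = 1 \<and> lucas (2 * k + 3) mod 8 = 3"
proof (induction k)
  case 0
  then show ?case by (simp add: numeral_2_eq_2 numeral_3_eq_3)
next
  case (Suc k)
  have 1: "lucas (2 * Suc k + 2) = - lucas (2 * k + 3) - 4 * lucas (2 * k + 2)"
    by (simp add: numeral_2_eq_2 numeral_3_eq_3)
  have 2: "lucas (2 * Suc k + 3) = - lucas (2 * Suc k + 2) - 4 * lucas (2 * k + 3)"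
    by (simp add: numeral_2_eq_2 numeral_3_eq_3)
  have "lucas (2 * Suc k + 2) mod 8 = 1"
    unfolding 1 using Suc by presburger
  moreover from this have "lucas (2 * Suc k + 3) mod 8 = 3"
    unfolding 2 using Suc by presburger
  ultimately show ?case ..
qed

lemma lucas_mod_3: "lucas k mod 3 = 2"
proof (induction k rule: lucas.induct)
  case (3 k)
  then show ?case unfolding lucas.simps by presburger
qed auto

section \<open>The three families\<close>

lemma uncollapsed_2:
  assumes "n \<ge> 3"
  shows "uncollapsed (2 ^ n)"
proof -
  define j :: nat where "j = 2 ^ (n - 2)"
  have j4: "2 ^ n = 4 * j" and j2: "2 ^ (n - 1) = 2 * j"
    using assms by (auto simp: j_def power_eq_if eval_nat_numeral)
  obtain i where i: "j = 2 * i + 2"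
  proof
    have "n - 2 = Suc (n - 3)"
      using assms by simp
    then have "j = 2 * 2 ^ (n - 3)"
      by (simp add: j_def)
    moreover have "(2::nat) ^ (n - 3) \<ge> 1"
      by simp
    ultimately show "j = 2 * (2 ^ (n - 3) - 1) + 2"
      by linarith
  qed
  define N where "N = lucas j"
  have N8: "N mod 8 = 1" and N3: "N mod 3 = 2"
    using lucas_mod_8[of i] lucas_mod_3[of j] by (auto simp: N_def i)
  define s where "s = (N - 1) div 2"
  have Ns: "2 * s + 1 = N"
    using N8 unfolding s_def by presburger
  have dickson: "N dvd dickson s' j" if "N dvd 2 * s' + 1" for s'
  proof -
    have "N dvd 2 ^ j * dickson s' j"
      using dickson_lucas[OF that, of j] by (simp add: N_def dvd_diff_left_iff)
    moreover have "coprime N (2 ^ j)"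
      using N8 by (simp add: coprime_right_2_iff_odd) presburger
    ultimately show ?thesis
      by (simp add: coprime_dvd_mult_right_iff)
  qed
  \<comment> \<open>\<open>t = s + 2\<close> is 3/2 modulo \<open>N\<close>, where
    \<open>t - 2\<close> and \<open>1 - t\<close> agree; one fact serves both elements.\<close>
  have bc: "N dvd dickson (s + 2 - 2) j"
    using Ns by (intro dickson) simp
  have "2 * (1 - (s + 2)) + 1 = - N"
    using Ns by simp
  then have bac: "N dvd dickson (1 - (s + 2)) j"
    by (intro dickson) simp
  show ?thesis
  proof (rule uncollapsed_prime_power)
    show "vcong N ((bc (s + 2) ^^ 2 ^ n) v) v" for v
      unfolding j4 by (rule vcong_pow4[OF affine_rec_bc bc])
    show "vcong N ((bac (s + 2) ^^ 2 ^ n) v) v" for v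
      unfolding j4 by (rule vcong_pow4[OF affine_rec_bac bac])
    show "\<not> (\<forall>v. vcong N ((bc (s + 2) ^^ 2 ^ (n - 1)) v) v)"
    proof
      assume "\<forall>v. vcong N ((bc (s + 2) ^^ 2 ^ (n - 1)) v) v"
      then have "N dvd 2"
        using bc_trivial_dickson_half[OF _ j2 bc] by blast
      then have "N \<le> 2 \<and> - 2 \<le> N"
        using dvd_imp_le_int[of 2 N] by auto
      \<comment> \<open>Only 1 in this range is 1 modulo 8, but it is not 2 modulo 3.\<close>
      with N8 N3 show False by presburger
    qed
  qed (use assms in auto)
qed

lemma uncollapsed_3:
  assumes "n \<ge> 2"
  shows "uncollapsed (3 ^ n)"
proof -
  define k :: nat where "k = 3 ^ (n - 1)"
  have k3: "3 ^ n = 3 * k"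
    using assms by (simp add: k_def power_eq_if)
  obtain i where i: "k = 2 * i + 3"
  proof -
    have "odd k" by (simp add: k_def)
    moreover have "n - 1 = Suc (n - 2)"
      using assms by simp
    then have "k \<ge> 3"
      by (simp add: k_def)
    ultimately have "k = 2 * ((k - 3) div 2) + 3"
      by presburger
    then show thesis by (rule that)
  qed
  \<comment> \<open>This is 2^k (\<open>dickson s k\<close> + 1) at s = -1/2.\<close>
  define N where "N = lucas k + 2 ^ k"
  have "(2::int) ^ k = 8 * 4 ^ i"
    by (simp add: i power_add power_mult)
  moreover have "(4::int) ^ i mod 3 = 1"
    using power_mod[of "4::int" 3 i] by simp
  ultimately have N8: "N mod 8 = 3" and N3: "N mod 3 = 1"
    using lucas_mod_8[of i] lucas_mod_3[of k] unfolding N_def i[symmetric] by presburger+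
  define s where "s = (N - 1) div 2"
  have Ns: "2 * s + 1 = N"
    using N8 unfolding s_def by presburger
  have dickson: "N dvd dickson s' k + 1" if "N dvd 2 * s' + 1" for s'
  proof -
    have "N dvd (2 ^ k * dickson s' k - lucas k) + N"
      using dickson_lucas[OF that, of k] by simp
    then have "N dvd 2 ^ k * (dickson s' k + 1)"
      by (simp add: N_def algebra_simps)
    moreover have "coprime N (2 ^ k)"
      using N8 by (simp add: coprime_right_2_iff_odd) presburger
    ultimately show ?thesis
      by (simp add: coprime_dvd_mult_right_iff)
  qed
  have bc: "N dvd dickson (s + 2 - 2) k + 1"
    using Ns by (intro dickson) simp
  have "2 * (1 - (s + 2)) + 1 = - N"
    using Ns by simp
  then have bac: "N dvd dickson (1 - (s + 2)) k + 1"
    by (intro dickson) simp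
  show ?thesis
  proof (rule uncollapsed_prime_power)
    show "vcong N ((bc (s + 2) ^^ 3 ^ n) v) v" for v
      unfolding k3 by (rule vcong_pow3[OF affine_rec_bc bc])
    show "vcong N ((bac (s + 2) ^^ 3 ^ n) v) v" for v
      unfolding k3 by (rule vcong_pow3[OF affine_rec_bac bac])
    show "\<not> (\<forall>v. vcong N ((bc (s + 2) ^^ 3 ^ (n - 1)) v) v)"
    proof
      assume "\<forall>v. vcong N ((bc (s + 2) ^^ 3 ^ (n - 1)) v) v"
      then have "N dvd dickson (s + 2 - 2) k - 2"
        unfolding k_def by (intro bc_trivial_dickson_minus_2) blast
      from dvd_diff[OF bc this] have "N dvd 3"
        by simp
      then have "N \<le> 3 \<and> - 3 \<le> N"
        using dvd_imp_le_int[of 3 N] by auto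
      \<comment> \<open>Only 3 in this range is 3 modulo 8, but it is not 1 modulo 3.\<close>
      with N8 N3 show False by presburger
    qed
  qed (use assms in auto)
qed

lemma uncollapsed_5:
  assumes "n \<ge> 1"
  shows "uncollapsed (5 ^ n)"
proof (rule uncollapsed_prime_power)
  show "vcong (5 ^ n) ((bc 4 ^^ 5 ^ n) v) v" for v
    by (rule vcong_pow_5[OF affine_rec_bc]) simp
  show "vcong (5 ^ n) ((bac 4 ^^ 5 ^ n) v) v" for v
    by (rule vcong_pow_5[OF affine_rec_bac]) simp
  \<comment> \<open>\<open>bc 4\<close> is unipotent, and the \<open>C\<close> coordinate of this
    orbit counts the steps.\<close>
  define v :: "abc \<Rightarrow> int" where "v = (\<lambda>y. 0)(B := 1)"
  have v: "(bc 4 ^^ k) v A = 0 \<and> (bc 4 ^^ k) v B = 1 + 2 * int k \<and> (bc 4 ^^ k) v C = int k" for k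
    by (induction k) (auto simp: v_def bc_apply)
  have "\<not> vcong (5 ^ n) ((bc 4 ^^ 5 ^ (n - 1)) v) v"
  proof
    assume "vcong (5 ^ n) ((bc 4 ^^ 5 ^ (n - 1)) v) v"
    then have "(5::int) ^ n dvd 5 ^ (n - 1)"
      using v[of "5 ^ (n - 1)"] unfolding vcong_def all_abc by (simp add: v_def)
    then have "n \<le> n - 1"
      by (simp add: dvd_power_iff)
    with assms show False by simp
  qed
  then show "\<not> (\<forall>v. vcong (5 ^ n) ((bc 4 ^^ 5 ^ (n - 1)) v) v)"
    by blast
  show "prime (5::nat)" by simp
qed (use assms in auto)

theorem theorem6p7:
  shows "(\<forall>n::nat. n \<ge> 3 \<longrightarrow> uncollapsed (2 ^ n)) \<and>
         (\<forall>n::nat. n \<ge> 2 \<longrightarrow> uncollapsed (3 ^ n)) \<and>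
         (\<forall>n::nat. n \<ge> 1 \<longrightarrow> uncollapsed (5 ^ n))"
  using uncollapsed_2 uncollapsed_3 uncollapsed_5 by blast

end
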